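(* Let $T,m,n\ge1$ be integers, $1\le p<\infty$, $\gamma>0$, $c>0$, $\varepsilon>0$, let $D^t$, $F$ and $C$ be the cost matrices, transition costs and cost tensor defined in the context from a collection of $m$ trajectories $\mathbf{X}$ and a collection of $n$ trajectories $\mathbf{Y}$, let $\bar\lambda^t\in\mathbb{R}^{m+1}$ and $\tilde\lambda^t\in\mathbb{R}^{n+1}$ for $t=1,\dots,T$, and put $\bar u^t=\exp(\bar\lambda^t/\varepsilon)$, $\tilde u^t=\exp(\tilde\lambda^t/\varepsilon)$ (elementwise), $k^t_{(i,j)}=\exp(-D^t_{(i,j)}/\varepsilon)$ and $\hat k_{(i,j),(k,l)}=\exp(-F_{(i,j),(k,l)}/\varepsilon)$. Let $$M^{(\bar\lambda,\tilde\lambda)}_{(i_1,j_1),\dots,(i_T,j_T)}=\exp\!\left(-\frac{C_{(i_1,j_1),\dots,(i_T,j_T)}}{\varepsilon}\right)\prod_{t=1}^T\exp\!\left(\frac{\bar\lambda^t_{i_t}}{\varepsilon}\right)\prod_{t=1}^T\exp\!\left(\frac{\tilde\lambda^t_{j_t}}{\varepsilon}\right).$$ Then for every $\tau=1,\dots,T$, $i_\tau\in\{1,\dots,m+1\}$ and $j_\tau\in\{1,\dots,n+1\}$, $$P_\tau(M^{(\bar\lambda,\tilde\lambda)})_{(i_\tau,j_\tau)}=\overrightarrow{\Phi}^\tau_{(i_\tau,j_\tau)}\,k^\tau_{(i_\tau,j_\tau)}\,\bar u^\tau_{i_\tau}\,\tilde u^\tau_{j_\tau}\,\overleftarrow{\Phi}^\tau_{(i_\tau,j_\tau)},$$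 where $\overrightarrow{\Phi}$ and $\overleftarrow{\Phi}$ are defined recursively by $$\overrightarrow{\Phi}^\tau_{(i_\tau,j_\tau)}=\sum_{(i_{\tau-1},j_{\tau-1})}\overrightarrow{\Phi}^{\tau-1}_{(i_{\tau-1},j_{\tau-1})}\,k^{\tau-1}_{(i_{\tau-1},j_{\tau-1})}\,\hat k_{(i_{\tau-1},j_{\tau-1}),(i_\tau,j_\tau)}\,\bar u^{\tau-1}_{i_{\tau-1}}\,\tilde u^{\tau-1}_{j_{\tau-1}},\qquad \tau=2,\dots,T,$$ with $\overrightarrow{\Phi}^1_{(i_1,j_1)}=1$ for all $(i_1,j_1)$, and $$\overleftarrow{\Phi}^\tau_{(i_\tau,j_\tau)}=\sum_{(i_{\tau+1},j_{\tau+1})}\overleftarrow{\Phi}^{\tau+1}_{(i_{\tau+1},j_{\tau+1})}\,k^{\tau+1}_{(i_{\tau+1},j_{\tau+1})}\,\hat k_{(i_\tau,j_\tau),(i_{\tau+1},j_{\tau+1})}\,\bar u^{\tau+1}_{i_{\tau+1}}\,\tilde u^{\tau+1}_{j_{\tau+1}},\qquad \tau=1,\dots,T-1,$$ with $\overleftarrow{\Phi}^T_{(i_T,j_T)}=1$ for all $(i_T,j_T)$.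
   Context: Trajectories: a trajectory on time steps $\{1,\dots,T\}$ is a sequence $(\boldsymbol{x}^1,\dots,\boldsymbol{x}^T)$ of sets, where each $\boldsymbol{x}^t$ is either $\{x^t\}$ with $x^t\in\mathbb{R}^N$ or $\varnothing$. $\boldsymbol{x}_i^t$ ($i\le m$) and $\boldsymbol{y}_j^t$ ($j\le n$) are the states at time $t$ of the $i$-th trajectory of $\mathbf{X}$ and the $j$-th trajectory of $\mathbf{Y}$; $\boldsymbol{x}_{m+1}^t=\boldsymbol{y}_{n+1}^t=\varnothing$ for all $t$. For $i=1,\dots,m+1$, $j=1,\dots,n+1$: $(D^t_{(i,j)})^{1/p}=\min(\|x_i^t-y_j^t\|,c)$ if $\boldsymbol{x}_i^t=\{x_i^t\}$ and $\boldsymbol{y}_j^t=\{y_j^t\}$; $(D^t_{(i,j)})^{1/p}=0$ if $\boldsymbol{x}_i^t=\boldsymbol{y}_j^t=\varnothing$; $(D^t_{(i,j)})^{1/p}=c/2^{1/p}$ otherwise, where $\|\cdot\|$ is the norm on $\mathbb{R}^N$. For $i,k\in\{1,\dots,m+1\}$, $j,l\in\{1,\dots,n+1\}$: $F_{(i,j),(k,l)}=\frac{\gamma^p}{2}(1-\delta_{ik}\delta_{jl})\big((1-\delta_{k,m+1})(1-\delta_{l,n+1})+(1-\delta_{i,m+1})(1-\delta_{j,n+1})\big)$ if $i=k$, and $F_{(i,j),(k,l)}=\infty$ otherwise ($\delta$ is the Kronecker delta). The convention $\exp(-\infty)=0$ is used. $C_{(i_1,j_1),\dots,(i_T,j_T)}=\sum_{t=1}^T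 D^t_{(i_t,j_t)}+\sum_{t=1}^{T-1}F_{(i_t,j_t),(i_{t+1},j_{t+1})}$, for $i_t\in\{1,\dots,m+1\}$, $j_t\in\{1,\dots,n+1\}$. For a tensor $M$ with entries $M_{(i_1,j_1),\dots,(i_T,j_T)}$, $P_\tau(M)$ is the $(m+1)\times(n+1)$ matrix with $P_\tau(M)_{(i_\tau,j_\tau)}$ equal to the sum of $M_{(i_1,j_1),\dots,(i_T,j_T)}$ over all index pairs except $(i_\tau,j_\tau)$. Sums over $(i_t,j_t)$ range over $\{1,\dots,m+1\}\times\{1,\dots,n+1\}$. *)

theory Defs
  imports "HOL-Analysis.Analysis"
begin

text \<open>
  The state of a trajectory at one time step is a singleton or empty: \<open>Some x\<close> stands for
  the set \<open>{x}\<close> and \<open>None\<close> for the empty set.  A collection of \<open>m\<close> trajectories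
  is a function of the trajectory number and the time step; only its values at trajectory numbers
  \<open>1, \<dots>, m\<close> and time steps \<open>1, \<dots>, T\<close> are relevant.
\<close>

type_synonym 'a trajectory = "nat \<Rightarrow> 'a option"

text \<open>The dummy trajectory \<open>m + 1\<close> is empty at all times.\<close>

definition state :: "nat \<Rightarrow> (nat \<Rightarrow> 'a trajectory) \<Rightarrow> nat \<Rightarrow> nat \<Rightarrow> 'a option" where
  "state m X i t = (if i \<in> {1..m} then X i t else None)"

definition index_pairs :: "nat \<Rightarrow> nat \<Rightarrow> (nat \<times> nat) set" where
  "index_pairs m n = {1..m+1} \<times> {1..n+1}"

fun state_dist :: "real \<Rightarrow> real \<Rightarrow> 'a::real_normed_vector option \<Rightarrow> 'a option \<Rightarrow> real" where
  "state_dist p c (Some x) (Some y) = min (norm (x - y)) c"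
| "state_dist p c None None = 0"
| "state_dist p c _ _ = c / 2 powr (1 / p)"

text \<open>
  The cost \<open>D\<close> is nonnegative with prescribed \<open>p\<close>-th root \<open>state_dist\<close>.
\<close>

definition cost_D ::
  "real \<Rightarrow> real \<Rightarrow> nat \<Rightarrow> nat \<Rightarrow> (nat \<Rightarrow> 'a::real_normed_vector trajectory) \<Rightarrow> (nat \<Rightarrow> 'a trajectory)
    \<Rightarrow> nat \<Rightarrow> nat \<times> nat \<Rightarrow> real" where
  "cost_D p c m n X Y t = (\<lambda>(i, j). state_dist p c (state m X i t) (state n Y j t) powr p)"

definition kronecker :: "nat \<Rightarrow> nat \<Rightarrow> real" where
  "kronecker i k = (if i = k then 1 else 0)"

definition cost_F :: "real \<Rightarrow> real \<Rightarrow> nat \<Rightarrow> nat \<Rightarrow> nat \<times> nat \<Rightarrow> nat \<times> nat \<Rightarrow> ereal" where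
  "cost_F p \<gamma> m n = (\<lambda>(i, j) (k, l).
     if i = k then
       ereal (\<gamma> powr p / 2 * (1 - kronecker i k * kronecker j l)
         * ((1 - kronecker k (m+1)) * (1 - kronecker l (n+1))
            + (1 - kronecker i (m+1)) * (1 - kronecker j (n+1))))
     else \<infinity>)"

text \<open>
  A multi-index \<open>(i\<^sub>1, j\<^sub>1), \<dots>, (i\<^sub>T, j\<^sub>T)\<close> is a function \<open>s\<close> with
  \<open>s t = (i\<^sub>t, j\<^sub>t)\<close>, and a tensor is a function of such multi-indices.
\<close>

definition cost_C ::
  "nat \<Rightarrow> (nat \<Rightarrow> nat \<times> nat \<Rightarrow> real) \<Rightarrow> (nat \<times> nat \<Rightarrow> nat \<times> nat \<Rightarrow> ereal)
    \<Rightarrow> (nat \<Rightarrow> nat \<times> nat) \<Rightarrow> ereal" where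
  "cost_C T D F s = (\<Sum>t=1..T. ereal (D t (s t))) + (\<Sum>t\<in>{1..<T}. F (s t) (s (t+1)))"

text \<open>
  The exponential with \<open>exp (-\<infinity>) = 0\<close>.  Its (arbitrary) value at \<open>\<infinity>\<close> plays no role,
  as the costs are never \<open>-\<infinity>\<close>.
\<close>

definition exp_ereal :: "ereal \<Rightarrow> real" where
  "exp_ereal x = (if x = -\<infinity> then 0 else exp (real_of_ereal x))"

definition tensor_M ::
  "nat \<Rightarrow> real \<Rightarrow> ((nat \<Rightarrow> nat \<times> nat) \<Rightarrow> ereal) \<Rightarrow> (nat \<Rightarrow> nat \<Rightarrow> real) \<Rightarrow> (nat \<Rightarrow> nat \<Rightarrow> real)
    \<Rightarrow> (nat \<Rightarrow> nat \<times> nat) \<Rightarrow> real" where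
  "tensor_M T \<epsilon> C lbar ltilde s =
     exp_ereal (- (C s) / ereal \<epsilon>)
       * (\<Prod>t=1..T. exp (lbar t (fst (s t)) / \<epsilon>))
       * (\<Prod>t=1..T. exp (ltilde t (snd (s t)) / \<epsilon>))"

definition projection ::
  "nat \<Rightarrow> nat \<Rightarrow> nat \<Rightarrow> nat \<Rightarrow> ((nat \<Rightarrow> nat \<times> nat) \<Rightarrow> real) \<Rightarrow> nat \<times> nat \<Rightarrow> real" where
  "projection T m n \<tau> M a =
     (\<Sum>s | s \<in> {1..T} \<rightarrow>\<^sub>E index_pairs m n \<and> s \<tau> = a. M s)"

function Phi_fwd ::
  "nat \<Rightarrow> nat \<Rightarrow> (nat \<Rightarrow> nat \<times> nat \<Rightarrow> real) \<Rightarrow> (nat \<times> nat \<Rightarrow> nat \<times> nat \<Rightarrow> real)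
    \<Rightarrow> (nat \<Rightarrow> nat \<Rightarrow> real) \<Rightarrow> (nat \<Rightarrow> nat \<Rightarrow> real) \<Rightarrow> nat \<Rightarrow> nat \<times> nat \<Rightarrow> real" where
  "Phi_fwd m n k khat ubar utilde \<tau> a =
     (if \<tau> \<le> 1 then 1
      else \<Sum>(i, j)\<in>index_pairs m n.
             Phi_fwd m n k khat ubar utilde (\<tau> - 1) (i, j)
               * k (\<tau> - 1) (i, j) * khat (i, j) a * ubar (\<tau> - 1) i * utilde (\<tau> - 1) j)"
  by pat_completeness auto
termination
  by (relation "Wellfounded.measure (\<lambda>(m, n, k, khat, ubar, utilde, \<tau>, a). \<tau>)") auto

function Phi_bwd ::
  "nat \<Rightarrow> nat \<Rightarrow> nat \<Rightarrow> (nat \<Rightarrow> nat \<times> nat \<Rightarrow> real) \<Rightarrow> (nat \<times> nat \<Rightarrow> nat \<times> nat \<Rightarrow> real)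
    \<Rightarrow> (nat \<Rightarrow> nat \<Rightarrow> real) \<Rightarrow> (nat \<Rightarrow> nat \<Rightarrow> real) \<Rightarrow> nat \<Rightarrow> nat \<times> nat \<Rightarrow> real" where
  "Phi_bwd T m n k khat ubar utilde \<tau> a =
     (if T \<le> \<tau> then 1
      else \<Sum>(i, j)\<in>index_pairs m n.
             Phi_bwd T m n k khat ubar utilde (\<tau> + 1) (i, j)
               * k (\<tau> + 1) (i, j) * khat a (i, j) * ubar (\<tau> + 1) i * utilde (\<tau> + 1) j)"
  by pat_completeness auto
termination
  by (relation "Wellfounded.measure (\<lambda>(T, m, n, k, khat, ubar, utilde, \<tau>, a). T - \<tau>)") auto

declare Phi_fwd.simps [simp del] Phi_bwd.simps [simp del]

end

theory Submission
  imports Defs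
begin

text \<open>
  The tensor entry at \<open>s\<close> is the weight of \<open>s\<close>, read as a path through the index pairs: each
  visited pair contributes a vertex factor \<open>k\<close> times the two scalings \<open>u\<close>, and each step an edge
  factor \<open>khat\<close> (lemma \<open>tensor_M_eq_path_weight\<close>).  The reason is that \<open>exp\<close> turns sums of
  costs into products, which persists for infinite costs with \<open>exp (-\<infinity>) = 0\<close> because \<open>-\<infinity>\<close> never
  occurs among the costs.

  The projection is thus a sum of path weights with the vertex at time \<open>\<tau>\<close> fixed.
  Since a vertex interacts with its two neighbours only, the vertices can be summed out one at a
  time by distributivity: from the start up to \<open>\<tau>\<close> and from the end down to \<open>\<tau>\<close>
  (lemmas \<open>sum_paths_eliminate_prefix\<close> and \<open>sum_paths_eliminate_suffix\<close>).  Summing out the first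
  remaining vertex turns a factor \<open>F t\<close> on it into the factor \<open>F (t + 1)\<close> on its successor, by
  precisely the recursion that defines the forward message \<open>Phi_fwd\<close>; the backward message arises
  in the same way from the other end.  What remains is a single vertex, at time \<open>\<tau>\<close>, carrying
  its own weight and the two messages.
\<close>

section \<open>Summing out the ends of a path\<close>

definition path_weight ::
  "(nat \<Rightarrow> 'a \<Rightarrow> 'b::comm_semiring_1) \<Rightarrow> ('a \<Rightarrow> 'a \<Rightarrow> 'b) \<Rightarrow> nat \<Rightarrow> nat \<Rightarrow> (nat \<Rightarrow> 'a) \<Rightarrow> 'b" where
  "path_weight w g \<sigma> \<rho> s = (\<Prod>t=\<sigma>..\<rho>. w t (s t)) * (\<Prod>t\<in>{\<sigma>..<\<rho>}. g (s t) (s (Suc t)))"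

lemma path_weight_single [simp]: "path_weight w g \<sigma> \<sigma> s = w \<sigma> (s \<sigma>)"
  by (simp add: path_weight_def)

lemma path_weight_Suc_left:
  assumes "\<sigma> < \<rho>"
  shows "path_weight w g \<sigma> \<rho> (s(\<sigma> := y))
       = w \<sigma> y * g y (s (Suc \<sigma>)) * path_weight w g (Suc \<sigma>) \<rho> s"
proof -
  have V: "{\<sigma>..\<rho>} = insert \<sigma> {Suc \<sigma>..\<rho>}" and E: "{\<sigma>..<\<rho>} = insert \<sigma> {Suc \<sigma>..<\<rho>}"
    using assms by auto
  show ?thesis
    by (simp add: path_weight_def V E mult_ac)
qed

lemma path_weight_Suc_right:
  assumes "\<sigma> \<le> \<rho>"
  shows "path_weight w g \<sigma> (Suc \<rho>) (s(Suc \<rho> := y))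
       = path_weight w g \<sigma> \<rho> s * g (s \<rho>) y * w (Suc \<rho>) y"
proof -
  have V: "{\<sigma>..Suc \<rho>} = insert (Suc \<rho>) {\<sigma>..\<rho>}" and E: "{\<sigma>..<Suc \<rho>} = insert \<rho> {\<sigma>..<\<rho>}"
    using assms by auto
  have "(\<Prod>t=\<sigma>..\<rho>. w t ((s(Suc \<rho> := y)) t)) = (\<Prod>t=\<sigma>..\<rho>. w t (s t))"
    by (rule prod.cong) auto
  moreover have "(\<Prod>t\<in>{\<sigma>..<\<rho>}. g ((s(Suc \<rho> := y)) t) ((s(Suc \<rho> := y)) (Suc t)))
      = (\<Prod>t\<in>{\<sigma>..<\<rho>}. g (s t) (s (Suc t)))"
    by (rule prod.cong) auto
  ultimately show ?thesis
    by (simp add: path_weight_def V E mult_ac)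
qed

lemma sum_PiE_insert:
  assumes "x \<notin> I"
  shows "(\<Sum>s\<in>insert x I \<rightarrow>\<^sub>E A. f s) = (\<Sum>s\<in>I \<rightarrow>\<^sub>E A. \<Sum>y\<in>A. f (s(x := y)))"
proof -
  have "(\<Sum>s\<in>insert x I \<rightarrow>\<^sub>E A. f s) = (\<Sum>(y, s)\<in>A \<times> (I \<rightarrow>\<^sub>E A). f (s(x := y)))"
    unfolding PiE_insert_eq
    by (subst sum.reindex[OF inj_combinator[OF assms]]) (simp add: case_prod_unfold)
  also have "\<dots> = (\<Sum>y\<in>A. \<Sum>s\<in>I \<rightarrow>\<^sub>E A. f (s(x := y)))"
    by (simp add: sum.cartesian_product)
  also have "\<dots> = (\<Sum>s\<in>I \<rightarrow>\<^sub>E A. \<Sum>y\<in>A. f (s(x := y)))"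
    by (rule sum.swap)
  finally show ?thesis .
qed

text \<open>
  The factor \<open>F t\<close> carried by the first vertex is the accumulated effect of all vertices summed out
  before it.  The factor \<open>h\<close> makes room for everything that concerns the later part of the path:
  the constraint at time \<open>\<tau>\<close> and the message at the far end.
\<close>

lemma sum_paths_eliminate_prefix:
  fixes F :: "nat \<Rightarrow> 'a \<Rightarrow> 'b::comm_semiring_1"
  assumes "\<sigma> \<le> \<tau>" "\<tau> \<le> \<rho>"
    and F: "\<And>t b. \<sigma> \<le> t \<Longrightarrow> F (Suc t) b = (\<Sum>y\<in>A. F t y * w t y * g y b)"
    and h: "\<And>s t y. t < \<tau> \<Longrightarrow> h (s(t := y)) = h s"
  shows "(\<Sum>s\<in>{\<sigma>..\<rho>} \<rightarrow>\<^sub>E A. F \<sigma> (s \<sigma>) * path_weight w g \<sigma> \<rho> s * h s)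
       = (\<Sum>s\<in>{\<tau>..\<rho>} \<rightarrow>\<^sub>E A. F \<tau> (s \<tau>) * path_weight w g \<tau> \<rho> s * h s)"
  using assms(1,2) h
proof (induction \<tau> rule: dec_induct)
  case (step n)
  have I: "{n..\<rho>} = insert n {Suc n..\<rho>}" and "n < \<rho>"
    using step by auto
  have "(\<Sum>s\<in>{\<sigma>..\<rho>} \<rightarrow>\<^sub>E A. F \<sigma> (s \<sigma>) * path_weight w g \<sigma> \<rho> s * h s)
      = (\<Sum>s\<in>{n..\<rho>} \<rightarrow>\<^sub>E A. F n (s n) * path_weight w g n \<rho> s * h s)"
    using step by auto
  also have "\<dots> = (\<Sum>s\<in>{Suc n..\<rho>} \<rightarrow>\<^sub>E A. \<Sum>y\<in>A.
      F n y * (w n y * g y (s (Suc n)) * path_weight w g (Suc n) \<rho> s) * h s)"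
    unfolding I
    by (simp add: sum_PiE_insert path_weight_Suc_left[OF \<open>n < \<rho>\<close>] step.prems(2))
  also have "\<dots> = (\<Sum>s\<in>{Suc n..\<rho>} \<rightarrow>\<^sub>E A.
      F (Suc n) (s (Suc n)) * path_weight w g (Suc n) \<rho> s * h s)"
    using step.hyps by (simp add: F sum_distrib_left sum_distrib_right mult_ac)
  finally show ?case .
qed simp

lemma sum_paths_eliminate_suffix:
  fixes B :: "nat \<Rightarrow> 'a \<Rightarrow> 'b::comm_semiring_1"
  assumes "\<tau> \<le> \<rho>" "\<sigma> \<le> \<tau>"
    and B: "\<And>t b. t < \<rho> \<Longrightarrow> B t b = (\<Sum>y\<in>A. B (Suc t) y * w (Suc t) y * g b y)"
    and h: "\<And>s t y. \<tau> < t \<Longrightarrow> h (s(t := y)) = h s"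
  shows "(\<Sum>s\<in>{\<sigma>..\<rho>} \<rightarrow>\<^sub>E A. h s * path_weight w g \<sigma> \<rho> s * B \<rho> (s \<rho>))
       = (\<Sum>s\<in>{\<sigma>..\<tau>} \<rightarrow>\<^sub>E A. h s * path_weight w g \<sigma> \<tau> s * B \<tau> (s \<tau>))"
  using assms(1,2) h
proof (induction \<tau> rule: inc_induct)
  case (step n)
  have I: "{\<sigma>..Suc n} = insert (Suc n) {\<sigma>..n}"
    using step by auto
  have "(\<Sum>s\<in>{\<sigma>..\<rho>} \<rightarrow>\<^sub>E A. h s * path_weight w g \<sigma> \<rho> s * B \<rho> (s \<rho>))
      = (\<Sum>s\<in>{\<sigma>..Suc n} \<rightarrow>\<^sub>E A. h s * path_weight w g \<sigma> (Suc n) s * B (Suc n) (s (Suc n)))"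
    using step by auto
  also have "\<dots> = (\<Sum>s\<in>{\<sigma>..n} \<rightarrow>\<^sub>E A. \<Sum>y\<in>A.
      h s * (path_weight w g \<sigma> n s * g (s n) y * w (Suc n) y) * B (Suc n) y)"
    unfolding I
    by (simp add: sum_PiE_insert path_weight_Suc_right[OF \<open>\<sigma> \<le> n\<close>] step.prems(2))
  also have "\<dots> = (\<Sum>s\<in>{\<sigma>..n} \<rightarrow>\<^sub>E A. h s * path_weight w g \<sigma> n s * B n (s n))"
    using step.hyps by (simp add: B[of n] sum_distrib_left sum_distrib_right mult_ac)
  finally show ?case .
qed simp

text \<open>
  The constraint at time \<open>\<tau>\<close> is carried along as an indicator factor.  It leaves both
  eliminations untouched and only acts on the single vertex that is left over.
\<close>

lemma sum_path_weight_fixed_vertex: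
  fixes F B :: "nat \<Rightarrow> 'a \<Rightarrow> 'b::comm_semiring_1"
  assumes "finite A" "a \<in> A" "\<tau> \<in> {\<sigma>..\<rho>}"
    and F: "\<And>b. F \<sigma> b = 1" "\<And>t b. \<sigma> \<le> t \<Longrightarrow> F (Suc t) b = (\<Sum>y\<in>A. F t y * w t y * g y b)"
    and B: "\<And>b. B \<rho> b = 1" "\<And>t b. t < \<rho> \<Longrightarrow> B t b = (\<Sum>y\<in>A. B (Suc t) y * w (Suc t) y * g b y)"
  shows "(\<Sum>s | s \<in> {\<sigma>..\<rho>} \<rightarrow>\<^sub>E A \<and> s \<tau> = a. path_weight w g \<sigma> \<rho> s) = F \<tau> a * w \<tau> a * B \<tau> a"
proof -
  let ?\<delta> = "\<lambda>y. if y = a then 1 else 0 :: 'b"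
  have fin: "finite ({\<sigma>..\<rho>} \<rightarrow>\<^sub>E A)"
    using \<open>finite A\<close> by (simp add: finite_PiE)
  have "(\<Sum>s | s \<in> {\<sigma>..\<rho>} \<rightarrow>\<^sub>E A \<and> s \<tau> = a. path_weight w g \<sigma> \<rho> s)
      = (\<Sum>s\<in>{\<sigma>..\<rho>} \<rightarrow>\<^sub>E A. if s \<tau> = a then path_weight w g \<sigma> \<rho> s else 0)"
    using sum.inter_filter[OF fin] by simp
  also have "\<dots> = (\<Sum>s\<in>{\<sigma>..\<rho>} \<rightarrow>\<^sub>E A. F \<sigma> (s \<sigma>) * path_weight w g \<sigma> \<rho> s * (?\<delta> (s \<tau>) * B \<rho> (s \<rho>)))"
    by (intro sum.cong) (auto simp: F B)
  also have "\<dots> = (\<Sum>s\<in>{\<tau>..\<rho>} \<rightarrow>\<^sub>E A. F \<tau> (s \<tau>) * path_weight w g \<tau> \<rho> s * (?\<delta> (s \<tau>) * B \<rho> (s \<rho>)))"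
    using assms(3) by (intro sum_paths_eliminate_prefix F) auto
  also have "\<dots> = (\<Sum>s\<in>{\<tau>..\<rho>} \<rightarrow>\<^sub>E A. (F \<tau> (s \<tau>) * ?\<delta> (s \<tau>)) * path_weight w g \<tau> \<rho> s * B \<rho> (s \<rho>))"
    by (simp add: mult_ac)
  also have "\<dots> = (\<Sum>s\<in>{\<tau>..\<tau>} \<rightarrow>\<^sub>E A. (F \<tau> (s \<tau>) * ?\<delta> (s \<tau>)) * path_weight w g \<tau> \<tau> s * B \<tau> (s \<tau>))"
    using assms(3) by (intro sum_paths_eliminate_suffix B) auto
  also have "\<dots> = (\<Sum>y\<in>A. (F \<tau> y * ?\<delta> y) * w \<tau> y * B \<tau> y)"
    by (simp add: sum_PiE_insert[where I = "{}"])
  also have "\<dots> = (\<Sum>y\<in>A. if y = a then F \<tau> y * w \<tau> y * B \<tau> y else 0)"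
    by (intro sum.cong) auto
  also have "\<dots> = F \<tau> a * w \<tau> a * B \<tau> a"
    using \<open>finite A\<close> \<open>a \<in> A\<close> by simp
  finally show ?thesis .
qed

section \<open>The exponential of a total cost\<close>

text \<open>
  A cost \<open>-\<infinity>\<close> has to be excluded: it absorbs every finite cost added to it, whereas
  multiplying \<open>exp_ereal \<infinity> = 1\<close> by a factor other than \<open>1\<close> changes it.
\<close>

lemma exp_ereal_neg_add:
  assumes "\<epsilon> > 0" "x \<noteq> -\<infinity>" "y \<noteq> -\<infinity>"
  shows "exp_ereal (- (x + y) / ereal \<epsilon>) = exp_ereal (- x / ereal \<epsilon>) * exp_ereal (- y / ereal \<epsilon>)"
  using assms
  by (cases x; cases y) (auto simp: exp_ereal_def exp_add[symmetric] field_simps add_divide_distrib)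

lemma sum_ereal_neq_MInfty:
  assumes "\<And>t. t \<in> I \<Longrightarrow> f t \<noteq> (-\<infinity> :: ereal)"
  shows "(\<Sum>t\<in>I. f t) \<noteq> -\<infinity>"
  using assms
proof (induction I rule: infinite_finite_induct)
  case (insert t I)
  then show ?case
    by (auto simp: ereal_plus_eq_MInfty)
qed simp_all

lemma exp_ereal_neg_sum:
  assumes "\<epsilon> > 0" "\<And>t. t \<in> I \<Longrightarrow> f t \<noteq> -\<infinity>"
  shows "exp_ereal (- (\<Sum>t\<in>I. f t) / ereal \<epsilon>) = (\<Prod>t\<in>I. exp_ereal (- f t / ereal \<epsilon>))"
  using assms(2)
proof (induction I rule: infinite_finite_induct)
  case (insert t I)
  then have "(\<Sum>t\<in>I. f t) \<noteq> -\<infinity>"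
    by (intro sum_ereal_neq_MInfty) auto
  with insert exp_ereal_neg_add[OF assms(1), of "f t" "\<Sum>t\<in>I. f t"] show ?case
    by simp
qed (simp_all add: exp_ereal_def)

lemma exp_ereal_neg_ereal:
  "\<epsilon> > 0 \<Longrightarrow> exp_ereal (- ereal x / ereal \<epsilon>) = exp (- x / \<epsilon>)"
  by (simp add: exp_ereal_def)

lemma tensor_M_eq_path_weight:
  assumes "\<epsilon> > 0" and F: "\<And>a b. F a b \<noteq> -\<infinity>"
  shows "tensor_M T \<epsilon> (cost_C T D F) lbar ltilde s
       = path_weight
           (\<lambda>t a. exp (- D t a / \<epsilon>) * exp (lbar t (fst a) / \<epsilon>) * exp (ltilde t (snd a) / \<epsilon>))
           (\<lambda>a b. exp_ereal (- F a b / ereal \<epsilon>)) 1 T s"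
proof -
  have "(\<Sum>t=1..T. ereal (D t (s t))) \<noteq> -\<infinity>" "(\<Sum>t\<in>{1..<T}. F (s t) (s (t+1))) \<noteq> -\<infinity>"
    by (intro sum_ereal_neq_MInfty; simp add: F)+
  then have "exp_ereal (- cost_C T D F s / ereal \<epsilon>)
      = (\<Prod>t=1..T. exp (- D t (s t) / \<epsilon>))
        * (\<Prod>t\<in>{1..<T}. exp_ereal (- F (s t) (s (t+1)) / ereal \<epsilon>))"
    by (simp only: cost_C_def exp_ereal_neg_add[OF \<open>\<epsilon> > 0\<close>] exp_ereal_neg_sum[OF \<open>\<epsilon> > 0\<close>] F
        exp_ereal_neg_ereal[OF \<open>\<epsilon> > 0\<close>] not_False_eq_True MInfty_neq_ereal)
  then show ?thesis
    by (simp add: tensor_M_def path_weight_def prod.distrib mult_ac)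
qed

lemma cost_F_neq_MInfty: "cost_F p \<gamma> m n a b \<noteq> -\<infinity>"
  by (auto simp: cost_F_def split: prod.splits)

section \<open>The projections of the tensor\<close>

theorem theorem2:
  fixes T m n :: nat
    and p \<gamma> c \<epsilon> :: real
    and X Y :: "nat \<Rightarrow> (real ^ 'N) trajectory"
    and lbar ltilde :: "nat \<Rightarrow> nat \<Rightarrow> real"
    and D k :: "nat \<Rightarrow> nat \<times> nat \<Rightarrow> real"
    and F :: "nat \<times> nat \<Rightarrow> nat \<times> nat \<Rightarrow> ereal"
    and khat :: "nat \<times> nat \<Rightarrow> nat \<times> nat \<Rightarrow> real"
    and C :: "(nat \<Rightarrow> nat \<times> nat) \<Rightarrow> ereal"
    and M :: "(nat \<Rightarrow> nat \<times> nat) \<Rightarrow> real"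
    and ubar utilde :: "nat \<Rightarrow> nat \<Rightarrow> real"
  assumes "T \<ge> 1" and "m \<ge> 1" and "n \<ge> 1"
    and "p \<ge> 1" and "\<gamma> > 0" and "c > 0" and "\<epsilon> > 0"
  defines "D \<equiv> cost_D p c m n X Y"
    and "F \<equiv> cost_F p \<gamma> m n"
    and "C \<equiv> cost_C T D F"
    and "ubar \<equiv> \<lambda>t i. exp (lbar t i / \<epsilon>)"
    and "utilde \<equiv> \<lambda>t j. exp (ltilde t j / \<epsilon>)"
    and "k \<equiv> \<lambda>t a. exp (- D t a / \<epsilon>)"
    and "khat \<equiv> \<lambda>a b. exp_ereal (- F a b / ereal \<epsilon>)"
    and "M \<equiv> tensor_M T \<epsilon> C lbar ltilde"
  shows "\<forall>\<tau>\<in>{1..T}. \<forall>i\<in>{1..m+1}. \<forall>j\<in>{1..n+1}.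
    projection T m n \<tau> M (i, j) =
      Phi_fwd m n k khat ubar utilde \<tau> (i, j) * k \<tau> (i, j) * ubar \<tau> i * utilde \<tau> j
        * Phi_bwd T m n k khat ubar utilde \<tau> (i, j)"
proof (intro ballI)
  fix \<tau> i j
  assume \<tau>: "\<tau> \<in> {1..T}" and "i \<in> {1..m+1}" "j \<in> {1..n+1}"
  then have ij: "(i, j) \<in> index_pairs m n"
    by (simp add: index_pairs_def)
  define w where "w = (\<lambda>t a. k t a * ubar t (fst a) * utilde t (snd a))"
  have M: "M s = path_weight w khat 1 T s" for s
    unfolding M_def C_def w_def k_def khat_def ubar_def utilde_def
    using \<open>\<epsilon> > 0\<close> by (rule tensor_M_eq_path_weight) (simp add: F_def cost_F_neq_MInfty)
  have "projection T m n \<tau> M (i, j)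
      = Phi_fwd m n k khat ubar utilde \<tau> (i, j) * w \<tau> (i, j)
        * Phi_bwd T m n k khat ubar utilde \<tau> (i, j)"
    unfolding projection_def M
  proof (rule sum_path_weight_fixed_vertex)
    show "finite (index_pairs m n)"
      by (simp add: index_pairs_def)
    show "Phi_fwd m n k khat ubar utilde (Suc t) b
        = (\<Sum>y\<in>index_pairs m n. Phi_fwd m n k khat ubar utilde t y * w t y * khat y b)"
      if "1 \<le> t" for t b
      using that by (subst Phi_fwd.simps) (simp add: w_def case_prod_unfold mult_ac)
    show "Phi_bwd T m n k khat ubar utilde t b
        = (\<Sum>y\<in>index_pairs m n. Phi_bwd T m n k khat ubar utilde (Suc t) y * w (Suc t) y * khat b y)"
      if "t < T" for t b
      using that by (subst Phi_bwd.simps) (simp add: w_def case_prod_unfold mult_ac)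
  qed (use \<tau> ij in \<open>simp_all add: Phi_fwd.simps[of _ _ _ _ _ _ "Suc 0"] Phi_bwd.simps[of _ _ _ _ _ _ _ T]\<close>)
  then show "projection T m n \<tau> M (i, j) =
      Phi_fwd m n k khat ubar utilde \<tau> (i, j) * k \<tau> (i, j) * ubar \<tau> i * utilde \<tau> j
        * Phi_bwd T m n k khat ubar utilde \<tau> (i, j)"
    by (simp add: w_def mult_ac)
qed

end
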